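(* Let $G$ be a nonbipartite graph with domination number $\gamma(G)$. Then $G$ contains a unicyclic spanning subgraph $H$ with both $g(H)=g_{o}(G)$ and $\gamma(H)=\gamma(G)$.
   Context: All graphs are finite, connected, undirected and simple. A dominating set of a graph $G$ is a set $D\subseteq V(G)$ such that every vertex of $V(G)\setminus D$ is adjacent to at least one vertex of $D$; the domination number $\gamma(G)$ is the minimum cardinality of a dominating set of $G$. The girth $g(G)$ is the length of a shortest cycle of $G$; for a nonbipartite graph $G$, the odd girth $g_o(G)$ is the length of a shortest odd cycle of $G$. A connected graph of order $n$ (i.e. with $n$ vertices) is unicyclic if it has exactly $n$ edges. A unicyclic spanning subgraph of $G$ is a spanning subgraph of $G$ (a subgraph with vertex set $V(G)$) which is unicyclic (in particular connected). *)

theory Defs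
  imports "Graph_Theory.Graph_Theory" "HOL-Library.Extended_Nat"
begin

text \<open>
  A finite simple undirected graph is a \<^locale>\<open>pair_graph\<close>: a finite vertex set with a
  symmetric irreflexive arc relation. Each undirected edge \<open>uv\<close> is present as the two
  arcs \<open>(u, v)\<close> and \<open>(v, u)\<close>.
\<close>

definition connected_graph :: "'a pair_pre_digraph \<Rightarrow> bool" where
  "connected_graph G \<longleftrightarrow> pair_graph G \<and> Digraph_Component.connected (with_proj G)"

definition undirected_edges :: "'a pair_pre_digraph \<Rightarrow> 'a set set" where
  "undirected_edges G = (\<lambda>(u, v). {u, v}) ` parcs G"

definition bipartite :: "'a pair_pre_digraph \<Rightarrow> bool" where
  "bipartite G \<longleftrightarrow> (\<exists>A B. A \<union> B = pverts G \<and> A \<inter> B = {} \<and>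
     (\<forall>(u, v) \<in> parcs G. (u \<in> A \<and> v \<in> B) \<or> (u \<in> B \<and> v \<in> A)))"

definition dominating_set :: "'a pair_pre_digraph \<Rightarrow> 'a set \<Rightarrow> bool" where
  "dominating_set G D \<longleftrightarrow> D \<subseteq> pverts G \<and> (\<forall>v \<in> pverts G - D. \<exists>d \<in> D. (v, d) \<in> parcs G)"

definition domination_number :: "'a pair_pre_digraph \<Rightarrow> nat" where
  "domination_number G = (LEAST k. \<exists>D. dominating_set G D \<and> card D = k)"

text \<open>
  The library's \<^const>\<open>pre_digraph.cycle\<close> is the directed notion, for which
  traversing one edge back and forth is a cycle of length two; this is excluded here.
\<close>

definition undirected_cycle :: "'a pair_pre_digraph \<Rightarrow> ('a \<times> 'a) awalk \<Rightarrow> bool" where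
  "undirected_cycle G p \<longleftrightarrow> pre_digraph.cycle (with_proj G) p \<and> 3 \<le> length p"

text \<open>The girth (odd girth) is \<open>\<infinity>\<close> if there is no cycle (odd cycle).\<close>

definition girth :: "'a pair_pre_digraph \<Rightarrow> enat" where
  "girth G = (INF p \<in> {p. undirected_cycle G p}. enat (length p))"

definition odd_girth :: "'a pair_pre_digraph \<Rightarrow> enat" where
  "odd_girth G = (INF p \<in> {p. undirected_cycle G p \<and> odd (length p)}. enat (length p))"

definition unicyclic :: "'a pair_pre_digraph \<Rightarrow> bool" where
  "unicyclic G \<longleftrightarrow> connected_graph G \<and> card (undirected_edges G) = card (pverts G)"

end

theory Submission
  imports Defs
begin

text \<open>
  Let \<open>g\<close> be the least length of an odd closed walk. Such a walk of length \<open>g\<close> is automatically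
  a chordless cycle \<open>C\<close>: a repeated vertex or a chord would split it into two closed walks, and
  the odd one of them would be shorter. So \<open>g\<close> is the odd girth, and cycles can be handled as
  closed walks throughout.

  Fix a minimum dominating set \<open>D\<close> and choose \<open>C\<close> among the shortest odd cycles so that it
  contains as many vertices of \<open>D\<close> as possible. Let every vertex \<open>v\<close> outside \<open>D\<close> select a
  neighbour \<open>d v\<close> in \<open>D\<close>, where a vertex of \<open>C\<close> selects a neighbour on \<open>C\<close> if it can. The only
  obstruction to adding all these edges to \<open>C\<close> without closing a second cycle would be a vertex
  \<open>d\<close> off \<open>C\<close> selected by two vertices \<open>x\<close> and \<open>z\<close> of \<open>C\<close>. By minimality of \<open>g\<close>, the vertices
  \<open>x\<close> and \<open>z\<close> are then joined by a path \<open>x, y, z\<close> on \<open>C\<close> (lemma \<open>common_neighbour_detour\<close>), and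
  \<open>y\<close> is not in \<open>D\<close>, as otherwise \<open>x\<close> would have selected a vertex of \<open>C\<close>. Replacing \<open>y\<close> by
  \<open>d\<close> gives another shortest odd cycle with one more vertex of \<open>D\<close>, which contradicts the
  choice of \<open>C\<close> (lemma \<open>private_dominators\<close>).

  The selected edges form disjoint stars. A star whose centre is on \<open>C\<close> has its leaves off \<open>C\<close> or
  attached by edges of \<open>C\<close>; any other star meets \<open>C\<close> in at most one leaf. It remains to hang
  all stars onto \<open>C\<close> as trees. This is encoded by a parent for every vertex off \<open>C\<close> and a rank
  that decreases towards the parent: a star that does not meet \<open>C\<close> is
  entered at a vertex closest to \<open>C\<close>, whose parent lies in a closer star, and the star edges
  lead all other vertices of the star towards the entry (lemma \<open>parents_along_stars\<close>). A cycle
  with such parent edges attached has as many edges as vertices, is connected, and has no cycle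
  besides \<open>C\<close>, since a vertex of maximal rank on another cycle would have only its parent as a
  neighbour there (locale \<open>parent_forest\<close>). All edges from \<open>v\<close> to \<open>d v\<close> survive, hence \<open>D\<close> still
  dominates, while deleting edges cannot decrease the domination number.
\<close>

section \<open>Closed walks and cycles\<close>

definition closed_walk :: "'a rel \<Rightarrow> nat \<Rightarrow> (nat \<Rightarrow> 'a) \<Rightarrow> bool" where
  "closed_walk E n f \<longleftrightarrow> f n = f 0 \<and> (\<forall>i<n. (f i, f (Suc i)) \<in> E)"

definition walk_arcs :: "nat \<Rightarrow> (nat \<Rightarrow> 'a) \<Rightarrow> 'a rel" where
  "walk_arcs n f = (\<lambda>i. (f i, f (Suc i))) ` {..<n} \<union> (\<lambda>i. (f (Suc i), f i)) ` {..<n}"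

lemma sym_walk_arcs: "sym (walk_arcs n f)"
  by (auto simp: walk_arcs_def sym_def)

lemma walk_arcs_forward: "i < n \<Longrightarrow> (f i, f (Suc i)) \<in> walk_arcs n f"
  and walk_arcs_backward: "i < n \<Longrightarrow> (f (Suc i), f i) \<in> walk_arcs n f"
  by (auto simp: walk_arcs_def)

lemma walk_segment_relpow:
  assumes "\<And>i. i < n \<Longrightarrow> (f i, f (Suc i)) \<in> E" "j \<le> k" "k \<le> n"
  shows "(f j, f k) \<in> E ^^ (k - j)"
  using assms(2,3)
proof (induction k rule: dec_induct)
  case (step m)
  then have "(f j, f (Suc m)) \<in> E ^^ Suc (m - j)" using assms(1)[of m] by auto
  then show ?case using step by (simp add: Suc_diff_le)
qed simp

lemma sym_relpow_flip: "sym E \<Longrightarrow> (x, y) \<in> E ^^ n \<Longrightarrow> (y, x) \<in> E ^^ n"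
proof (induction n arbitrary: y)
  case (Suc n)
  then obtain z where "(x, z) \<in> E ^^ n" "(z, y) \<in> E" by auto
  then show ?case using Suc by (meson relpow_Suc_I2 symD)
qed simp

text \<open>
  A cycle as an indexed sequence of distinct vertices. No adjacency relation is fixed here, since
  the same sequence is considered both in \<open>G\<close> and in its spanning subgraph.
\<close>

locale vertex_cycle =
  fixes f :: "nat \<Rightarrow> 'a" and g :: nat
  assumes inj_f: "inj_on f {..<g}"
    and wrap: "f g = f 0"
    and length_ge_3: "3 \<le> g"
begin

abbreviation (input) "C \<equiv> f ` {..<g}"

text \<open>
  The cyclic predecessor of an index; successors need no such case distinction because the
  sequence has the value \<open>f 0\<close> again at index \<open>g\<close>.
\<close>

definition before :: "nat \<Rightarrow> nat" where
  "before i = (if i = 0 then g - 1 else i - 1)"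

lemma f_eq_iff: "i < g \<Longrightarrow> j < g \<Longrightarrow> f i = f j \<longleftrightarrow> i = j"
  using inj_f by (auto simp: inj_on_def)

lemma f_Suc_in_C: "i < g \<Longrightarrow> f (Suc i) \<in> C"
  using wrap length_ge_3 by (cases "Suc i = g") auto

lemma walk_arcs_subset: "walk_arcs g f \<subseteq> C \<times> C"
  using f_Suc_in_C by (auto simp: walk_arcs_def)

lemma f_Suc_eq:
  assumes "i < g" "j < g" "f i = f (Suc j)"
  shows "i = Suc j \<or> i = 0 \<and> j = g - 1"
proof (cases "Suc j = g")
  case True
  with assms wrap have "f i = f 0" by simp
  then show ?thesis using f_eq_iff[of i 0] assms True by auto
next
  case False
  then show ?thesis using f_eq_iff[of i "Suc j"] assms by auto
qed

lemma walk_arcs_neighbours: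
  assumes "i < g" "(f i, w) \<in> walk_arcs g f"
  shows "w = f (Suc i) \<or> w = f (before i)"
proof -
  from assms(2) obtain j where j: "j < g" and
    "f i = f j \<and> w = f (Suc j) \<or> f i = f (Suc j) \<and> w = f j"
    by (auto simp: walk_arcs_def)
  then show ?thesis
    using f_eq_iff[OF assms(1) j] f_Suc_eq[OF assms(1) j] by (auto simp: before_def)
qed

lemma walk_arcs_irrefl: "(x, x) \<notin> walk_arcs g f"
proof
  assume "(x, x) \<in> walk_arcs g f"
  then obtain j where "j < g" "f j = f (Suc j)" by (auto simp: walk_arcs_def)
  then show False using f_Suc_eq[of j j] length_ge_3 by auto
qed

lemma card_cycle_vertices: "card C = g"
  using inj_f by (simp add: card_image)

lemma card_cycle_edges: "card ((\<lambda>i. {f i, f (Suc i)}) ` {..<g}) = g"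
proof -
  have "inj_on (\<lambda>i. {f i, f (Suc i)}) {..<g}"
  proof (rule inj_onI, rule ccontr)
    fix i j assume ij: "i \<in> {..<g}" "j \<in> {..<g}" "{f i, f (Suc i)} = {f j, f (Suc j)}" "i \<noteq> j"
    then have "f i \<noteq> f j" using f_eq_iff by auto
    then have "f i = f (Suc j)" "f j = f (Suc i)" using ij(3) by (auto simp: doubleton_eq_iff)
    then show False using f_Suc_eq[of i j] f_Suc_eq[of j i] ij length_ge_3 by auto
  qed
  then show ?thesis by (simp add: card_image)
qed

lemma two_cycle_neighbours:
  assumes "closed_walk E g f" "sym E" "v \<in> C"
  shows "\<exists>a\<in>C. \<exists>b\<in>C. a \<noteq> b \<and> (v, a) \<in> E \<and> (v, b) \<in> E"
proof -
  from assms(3) obtain i where i: "i < g" "v = f i" by auto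
  have b: "before i < g" using i by (auto simp: before_def)
  have "f (Suc (before i)) = f i" using i wrap by (auto simp: before_def)
  then have "(v, f (before i)) \<in> E"
    using assms b i by (metis closed_walk_def symD)
  moreover have "(v, f (Suc i)) \<in> E" using assms i by (auto simp: closed_walk_def)
  moreover have "f (Suc i) \<noteq> f (before i)"
    using f_Suc_eq[OF b i(1)] length_ge_3 i by (auto simp: before_def split: if_splits)
  ultimately show ?thesis using f_Suc_in_C[OF i(1)] b by blast
qed

text \<open>
  A cycle has no proper nonempty part in which all degrees are two: since each vertex has only two
  neighbours along the cycle, such a part contains with a vertex also its successor.
\<close>

lemma vertex_set_closed_under_cycle:
  assumes "S \<subseteq> C" "S \<noteq> {}"
    and two: "\<And>v. v \<in> S \<Longrightarrow> \<exists>a\<in>S. \<exists>b\<in>S. a \<noteq> b \<and> (v, a) \<in> walk_arcs g f \<and> (v, b) \<in> walk_arcs g f"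
  shows "S = C"
proof -
  have step: "f (Suc i) \<in> S" if "f i \<in> S" "i < g" for i
    using two[OF that(1)] walk_arcs_neighbours[OF that(2)] by metis
  from assms obtain i where i: "i < g" "f i \<in> S" by auto
  have up: "f k \<in> S" if "f j \<in> S" "j \<le> k" "k \<le> g" for j k
    using that(2,1,3) by (induction k rule: dec_induct) (auto intro: step)
  have "f 0 \<in> S" using up[of i g] i wrap by auto
  then have "f k \<in> S" if "k < g" for k using up[of 0 k] that by auto
  then show ?thesis using assms(1) by auto
qed

end

section \<open>Shortest odd closed walks\<close>

text \<open>
  Minimality is stated with relational powers, so that a shorter odd closed walk can be exhibited
  by composing walks without building its vertex sequence.
\<close>

locale shortest_odd_walk =
  fixes E :: "'a rel" and f :: "nat \<Rightarrow> 'a" and g :: nat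
  assumes sym_E: "sym E"
    and irrefl_E: "(x, x) \<notin> E"
    and closed: "closed_walk E g f"
    and odd_g: "odd g"
    and shortest: "odd n \<Longrightarrow> (x, x) \<in> E ^^ n \<Longrightarrow> g \<le> n"
begin

lemma wrap_walk: "f g = f 0" and step: "i < g \<Longrightarrow> (f i, f (Suc i)) \<in> E"
  using closed by (auto simp: closed_walk_def)

text \<open>
  Two positions cut the closed walk into two walks whose lengths sum to the odd number \<open>g\<close>, so
  exactly one of them is odd. All minimality arguments below close the walk of suitable parity.
\<close>

lemma arc_walks:
  assumes "i < j" "j < g"
  shows "(f i, f j) \<in> E ^^ (j - i)"
    "(f j, f i) \<in> E ^^ (g - (j - i))" "(f i, f j) \<in> E ^^ (g - (j - i))"
proof -
  show "(f i, f j) \<in> E ^^ (j - i)" using walk_segment_relpow[of g f E i j] step assms by simp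
  have "(f j, f g) \<in> E ^^ (g - j)" using walk_segment_relpow[of g f E j g] step assms by simp
  moreover have "(f 0, f i) \<in> E ^^ i" using walk_segment_relpow[of g f E 0 i] step assms by simp
  ultimately have "(f j, f i) \<in> E ^^ (g - j + i)" using wrap_walk relpow_trans by metis
  moreover have "g - j + i = g - (j - i)" using assms by simp
  ultimately show "(f j, f i) \<in> E ^^ (g - (j - i))" by simp
  then show "(f i, f j) \<in> E ^^ (g - (j - i))" by (rule sym_relpow_flip[OF sym_E])
qed

lemma inj_walk: "inj_on f {..<g}"
proof (rule linorder_inj_onI)
  fix i j assume ij: "i < j" "i \<in> {..<g}" "j \<in> {..<g}"
  show "f i \<noteq> f j"
  proof
    assume eq: "f i = f j"
    show False
    proof (cases "odd (j - i)")
      case True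
      then have "g \<le> j - i" using shortest arc_walks(1)[of i j] ij eq by auto
      then show False using ij by auto
    next
      case False
      then have "odd (g - (j - i))" using odd_g ij by auto
      then have "g \<le> g - (j - i)" using shortest arc_walks(2)[of i j] ij eq by auto
      then show False using ij by auto
    qed
  qed
qed auto

lemma walk_length_ge_3: "3 \<le> g"
proof -
  have "g \<noteq> 1" using step[of 0] wrap_walk irrefl_E by auto
  then show ?thesis using odd_g by (cases g; cases "g - 1"; cases "g - 2") auto
qed

sublocale vertex_cycle f g
  using inj_walk wrap_walk walk_length_ge_3 by unfold_locales

lemma no_chord:
  assumes "x \<in> C" "y \<in> C" "(x, y) \<in> E"
  shows "(x, y) \<in> walk_arcs g f"
proof -
  have "(f i, f j) \<in> walk_arcs g f" if ij: "i < j" "j < g" "(f i, f j) \<in> E" for i j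
  proof (cases "odd (j - i)")
    case True
    have "(f j, f j) \<in> E ^^ Suc (g - (j - i))"
      using arc_walks(2)[OF ij(1,2)] ij(3) by auto
    then have "g \<le> Suc (g - (j - i))" using shortest[of "Suc (g - (j - i))"] True odd_g ij by auto
    then have "j = Suc i" using ij by auto
    then show ?thesis using walk_arcs_forward[of i g f] ij by auto
  next
    case False
    have "(f i, f i) \<in> E ^^ Suc (j - i)"
      using arc_walks(1)[OF ij(1,2)] ij(3) sym_E by (meson relpow_Suc_I symD)
    then have "g \<le> Suc (j - i)" using shortest[of "Suc (j - i)"] False by auto
    then have "i = 0" "Suc j = g" using ij by auto
    then show ?thesis using walk_arcs_backward[of j g f] ij wrap by auto
  qed
  note * = this
  from assms obtain i j where ij: "i < g" "j < g" "x = f i" "y = f j" by auto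
  then have "i \<noteq> j" using assms irrefl_E by auto
  then consider "i < j" | "j < i" by linarith
  then show ?thesis
  proof cases
    case 1 then show ?thesis using * ij assms by auto
  next
    case 2
    then have "(y, x) \<in> walk_arcs g f" using * ij assms sym_E by (auto dest: symD)
    then show ?thesis using sym_walk_arcs[of g f] by (auto dest: symD)
  qed
qed

text \<open>
  Two vertices of the cycle with a common neighbour \<open>d\<close> are joined by an odd and by an even walk
  along the cycle. Closing the odd one through \<open>d\<close> gives an odd closed walk, so the odd walk has
  length at least \<open>g - 2\<close> and the even one has length two. Its middle vertex \<open>y\<close> has \<open>x\<close> and \<open>z\<close>
  as only neighbours along the cycle, so \<open>d\<close> can take the place of \<open>y\<close>. This includes triangles,
  where \<open>x\<close> and \<open>z\<close> are themselves adjacent.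
\<close>

lemma common_neighbour_detour:
  assumes "x \<in> C" "z \<in> C" "x \<noteq> z" "(d, x) \<in> E" "(d, z) \<in> E"
  shows "\<exists>y\<in>C. (x, y) \<in> walk_arcs g f \<and> (\<forall>w. (y, w) \<in> walk_arcs g f \<longrightarrow> (d, w) \<in> E)"
proof -
  have key: "\<exists>m<g. {f (Suc m), f (before m)} = {f i, f j}"
    if ij: "i < j" "j < g" "(d, f i) \<in> E" "(d, f j) \<in> E" for i j
  proof (cases "odd (j - i)")
    case True
    have "(d, d) \<in> E ^^ Suc (Suc (j - i))"
      using arc_walks(1)[OF ij(1,2)] ij(3,4) sym_E by (meson relpow_Suc_I relpow_Suc_I2 symD)
    then have "g \<le> Suc (Suc (j - i))" using shortest[of "Suc (Suc (j - i))"] True by auto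
    moreover have "j - i \<noteq> g - 1" using True odd_g ij by (cases g) auto
    \<comment> \<open>The even walk of length two passes through index \<open>0\<close>, which is the same vertex
      as index \<open>g\<close>: its middle vertex is the last or the first one of the sequence.\<close>
    ultimately have "i = 0 \<and> j = g - 2 \<or> i = 1 \<and> j = g - 1" using ij by auto
    then show ?thesis
    proof
      assume "i = 0 \<and> j = g - 2"
      then show ?thesis using length_ge_3 wrap
        by (intro exI[of _ "g - 1"]) (auto simp: before_def numeral_2_eq_2)
    next
      assume "i = 1 \<and> j = g - 1"
      then show ?thesis using length_ge_3 wrap
        by (intro exI[of _ 0]) (auto simp: before_def)
    qed
  next
    case False
    have "(d, d) \<in> E ^^ Suc (Suc (g - (j - i)))"
      using arc_walks(3)[OF ij(1,2)] ij(3,4) sym_E by (meson relpow_Suc_I relpow_Suc_I2 symD)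
    then have "g \<le> Suc (Suc (g - (j - i)))"
      using shortest[of "Suc (Suc (g - (j - i)))"] False ij odd_g by auto
    then have "j = i + 2" using ij False by (cases "j - i"; cases "j - i - 1") auto
    then show ?thesis using ij
      by (intro exI[of _ "i + 1"]) (auto simp: before_def)
  qed
  from assms obtain i j where ij: "i < g" "j < g" "x = f i" "z = f j" by auto
  then have "i \<noteq> j" using assms by auto
  then obtain m where m: "m < g" "{f (Suc m), f (before m)} = {x, z}"
    using key[of i j] key[of j i] assms ij by (cases i j rule: linorder_cases) (auto simp: insert_commute)
  have "Suc (before m) = m \<or> m = 0 \<and> Suc (before m) = g" "before m < g"
    using m(1) by (auto simp: before_def)
  then have "(f (before m), f m) \<in> walk_arcs g f"
    using walk_arcs_forward[of "before m" g f] wrap by auto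
  moreover have "(f (Suc m), f m) \<in> walk_arcs g f"
    using walk_arcs_backward m(1) .
  ultimately have "(x, f m) \<in> walk_arcs g f" using m(2) by (auto simp: doubleton_eq_iff)
  moreover have "(d, w) \<in> E" if "(f m, w) \<in> walk_arcs g f" for w
    using walk_arcs_neighbours[OF m(1) that] m(2) assms by (auto simp: doubleton_eq_iff)
  ultimately show ?thesis using m(1) by blast
qed

text \<open>
  Substituting vertices by value rather than by index treats the two ends of the sequence, which
  are the same vertex, simultaneously.
\<close>

lemma closed_walk_replace:
  assumes "y \<in> C" "\<And>w. (y, w) \<in> walk_arcs g f \<Longrightarrow> (d, w) \<in> E"
  shows "closed_walk E g (\<lambda>i. if f i = y then d else f i)"
  unfolding closed_walk_def
proof (intro conjI allI impI)
  show "(if f g = y then d else f g) = (if f 0 = y then d else f 0)" using wrap by simp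
next
  fix i assume i: "i < g"
  have "f i \<noteq> f (Suc i)" using step[OF i] irrefl_E by metis
  moreover have "(d, f (Suc i)) \<in> E" if "f i = y"
    using assms(2) walk_arcs_forward[OF i] that by metis
  moreover have "(f i, d) \<in> E" if "f (Suc i) = y"
    using assms(2) walk_arcs_backward[OF i] that sym_E by (metis symD)
  ultimately show "((if f i = y then d else f i), (if f (Suc i) = y then d else f (Suc i))) \<in> E"
    using step[OF i] by auto
qed

lemma replace_image:
  assumes "y \<in> C"
  shows "(\<lambda>i. if f i = y then d else f i) ` {..<g} = insert d (C - {y})"
  using assms by (auto simp: image_iff)

end


section \<open>Choosing dominators and parents\<close>

text \<open>
  If the cycle meets \<open>D\<close> as often as possible, then dominators can be chosen such that none off the
  cycle is responsible for two cycle vertices: otherwise the detour through it would replace a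
  vertex outside \<open>D\<close> by one in \<open>D\<close>.
\<close>

lemma (in shortest_odd_walk) private_dominators:
  assumes D: "finite D" "\<And>v. v \<in> V - D \<Longrightarrow> \<exists>c\<in>D. (v, c) \<in> E"
    and best: "\<And>f'. closed_walk E g f' \<Longrightarrow> card (f' ` {..<g} \<inter> D) \<le> card (C \<inter> D)"
  obtains d where "\<And>v. v \<in> V - D \<Longrightarrow> d v \<in> D \<and> (v, d v) \<in> E"
    and "\<And>x z. \<lbrakk>x \<in> C; z \<in> C; x \<in> V - D; z \<in> V - D; d x = d z; d x \<notin> C\<rbrakk> \<Longrightarrow> x = z"
proof -
  \<comment> \<open>A dominator on the cycle is preferred. Only then does \<open>d x \<notin> C\<close> imply that \<open>x\<close> has no
    neighbour in \<open>D\<close> on the cycle.\<close>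
  have "\<exists>c. c \<in> D \<and> (v, c) \<in> E \<and> ((\<exists>y\<in>C \<inter> D. (v, y) \<in> E) \<longrightarrow> c \<in> C)" if "v \<in> V - D" for v
    using D(2)[OF that] by blast
  then obtain d where d: "\<And>v. v \<in> V - D \<Longrightarrow> d v \<in> D \<and> (v, d v) \<in> E"
    and pref: "\<And>v y. \<lbrakk>v \<in> V - D; y \<in> C \<inter> D; (v, y) \<in> E\<rbrakk> \<Longrightarrow> d v \<in> C"
    by metis
  moreover have "x = z"
    if xz: "x \<in> C" "z \<in> C" "x \<in> V - D" "z \<in> V - D" "d x = d z" "d x \<notin> C" for x z
  proof (rule ccontr)
    assume "x \<noteq> z"
    moreover have "(d x, x) \<in> E" "(d x, z) \<in> E"
      using d[OF xz(3)] d[OF xz(4)] xz(5) sym_E by (auto dest: symD)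
    ultimately obtain y where y: "y \<in> C" "(x, y) \<in> walk_arcs g f"
      "\<And>w. (y, w) \<in> walk_arcs g f \<Longrightarrow> (d x, w) \<in> E"
      using common_neighbour_detour[of x z "d x"] xz by blast
    have "(x, y) \<in> E" using y(2) step sym_E by (auto simp: walk_arcs_def dest: symD)
    then have "y \<notin> D" using pref[of x y] xz y(1) by auto
    have "card (insert (d x) (C - {y}) \<inter> D) \<le> card (C \<inter> D)"
      using best[OF closed_walk_replace[OF y(1,3)]] replace_image[OF y(1)] by simp
    moreover have "insert (d x) (C - {y}) \<inter> D = insert (d x) (C \<inter> D)"
      using d[OF xz(3)] \<open>y \<notin> D\<close> by auto
    moreover have "card (insert (d x) (C \<inter> D)) = Suc (card (C \<inter> D))"
      using D(1) xz(6) by simp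
    ultimately show False by simp
  qed
  ultimately show ?thesis using that by blast
qed

lemma distance_to_set:
  fixes E :: "'a rel"
  assumes "sym E" "E \<subseteq> V \<times> V" "\<And>v. v \<in> V \<Longrightarrow> \<exists>x\<in>C. (x, v) \<in> E\<^sup>*"
  obtains dist :: "'a \<Rightarrow> nat" where "\<And>v. v \<in> C \<Longrightarrow> dist v = 0"
    and "\<And>v. v \<in> V - C \<Longrightarrow> \<exists>u\<in>V. (v, u) \<in> E \<and> dist u < dist v"
proof -
  define dist where "dist v = (LEAST k. \<exists>x\<in>C. (x, v) \<in> E ^^ k)" for v
  have "dist v = 0" if "v \<in> C" for v
    unfolding dist_def using that by (intro Least_eq_0) auto
  moreover have "\<exists>u\<in>V. (v, u) \<in> E \<and> dist u < dist v" if v: "v \<in> V - C" for v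
  proof -
    have "\<exists>k. \<exists>x\<in>C. (x, v) \<in> E ^^ k" using assms(3)[of v] v rtrancl_imp_relpow by blast
    then have "\<exists>x\<in>C. (x, v) \<in> E ^^ dist v" unfolding dist_def by (rule LeastI_ex)
    then obtain x where x: "x \<in> C" "(x, v) \<in> E ^^ dist v" by auto
    with v obtain k where k: "dist v = Suc k" by (cases "dist v") auto
    with x obtain u where u: "(x, u) \<in> E ^^ k" "(u, v) \<in> E" by auto
    have "dist u \<le> k" unfolding dist_def using x u by (intro Least_le) auto
    with u k assms show ?thesis by (intro bexI[of _ u]) (auto dest: symD)
  qed
  ultimately show ?thesis using that by blast
qed

text \<open>
  The map \<open>cen\<close> partitions the vertices into stars, the centres being its fixed points. Every star
  gets an entry, a vertex of the star that is closest to \<open>C\<close>, with the centre preferred if it lies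
  on \<open>C\<close>. The parents lead from an entry off \<open>C\<close> to a vertex closer to \<open>C\<close>, from a centre to the
  entry of its star, and from any other vertex to its centre. Thus every edge of a star
  with an end off \<open>C\<close> joins a vertex to its parent. If the leaf is on \<open>C\<close> and the centre is not, this
  depends on the last assumption, which makes that leaf the entry and hence the parent of the centre.
\<close>

lemma parents_along_stars:
  fixes E :: "'a rel" and dist :: "'a \<Rightarrow> nat"
  assumes "sym E"
    and dist: "\<And>v. v \<in> C \<Longrightarrow> dist v = 0"
      "\<And>v. v \<in> V - C \<Longrightarrow> \<exists>u\<in>V. (v, u) \<in> E \<and> dist u < dist v"
    and cen: "\<And>v. v \<in> V \<Longrightarrow> cen v \<in> V" "\<And>v. v \<in> V \<Longrightarrow> cen (cen v) = cen v"
      "\<And>v. v \<in> V \<Longrightarrow> cen v \<noteq> v \<Longrightarrow> (v, cen v) \<in> E"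
    and "C \<subseteq> V"
    and once: "\<And>x y. \<lbrakk>x \<in> C; y \<in> C; cen x = cen y; cen x \<notin> C\<rbrakk> \<Longrightarrow> x = y"
  obtains par :: "'a \<Rightarrow> 'a" and rank :: "'a \<Rightarrow> nat"
  where "\<And>v. v \<in> V - C \<Longrightarrow> par v \<in> V \<and> (v, par v) \<in> E \<and> rank (par v) < rank v"
    and "\<And>v. \<lbrakk>v \<in> V; cen v \<noteq> v\<rbrakk> \<Longrightarrow> v \<in> C \<and> cen v \<in> C \<or> v \<notin> C \<and> par v = cen v
      \<or> cen v \<notin> C \<and> par (cen v) = v"
proof -
  have "\<exists>t. t \<in> V \<and> cen t = c \<and> (\<forall>s\<in>V. cen s = c \<longrightarrow> dist t \<le> dist s) \<and> (c \<in> C \<longrightarrow> t = c)"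
    if c: "c \<in> V" "cen c = c" for c
  proof (cases "c \<in> C")
    case True
    then show ?thesis using c dist(1) by auto
  next
    case False
    then show ?thesis
      using ex_has_least_nat[of "\<lambda>t. t \<in> V \<and> cen t = c" c dist] c by auto
  qed
  then obtain entry where entry0: "\<And>c. c \<in> V \<Longrightarrow> cen c = c \<Longrightarrow> entry c \<in> V \<and> cen (entry c) = c
      \<and> (\<forall>s\<in>V. cen s = c \<longrightarrow> dist (entry c) \<le> dist s) \<and> (c \<in> C \<longrightarrow> entry c = c)"
    by metis
  have entry: "entry (cen v) \<in> V" "cen (entry (cen v)) = cen v"
      "dist (entry (cen v)) \<le> dist v" "cen v \<in> C \<Longrightarrow> entry (cen v) = cen v" if "v \<in> V" for v
    using entry0[of "cen v"] cen that by auto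
  obtain up where up: "\<And>v. v \<in> V - C \<Longrightarrow> up v \<in> V \<and> (v, up v) \<in> E \<and> dist (up v) < dist v"
    using dist(2) by metis
  define par where
    "par v = (if v = entry (cen v) then up v else if v = cen v then entry v else cen v)" for v
  \<comment> \<open>An entry step decreases the distance of the star; inside a star, the entry, the centre
    and the remaining leaves occupy three consecutive levels.\<close>
  define rank where "rank v = 3 * dist (entry (cen v)) +
    (if v = entry (cen v) then 0 else if v = cen v then 1 else 2)" for v
  have "par v \<in> V \<and> (v, par v) \<in> E \<and> rank (par v) < rank v" if v: "v \<in> V - C" for v
  proof -
    consider "v = entry (cen v)" | "v \<noteq> entry (cen v)" "v = cen v"
      | "v \<noteq> entry (cen v)" "v \<noteq> cen v" by blast
    then show ?thesis
    proof cases
      case 1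
      then have "dist (entry (cen (up v))) < dist (entry (cen v))"
        using up[OF v] entry(3)[of "up v"] by simp
      then have "rank (up v) < rank v" by (auto simp: rank_def)
      then show ?thesis using 1 up[OF v] by (simp add: par_def)
    next
      case 2
      define t where "t = entry v"
      have t: "t \<in> V" "cen t = v" "t \<noteq> v" using entry[of v] 2 v by (auto simp: t_def)
      then have "(v, t) \<in> E" using cen(3)[of t] \<open>sym E\<close> by (auto dest: symD)
      moreover have "rank t < rank v" using t 2 by (auto simp: rank_def t_def)
      ultimately show ?thesis using 2 t by (auto simp: par_def t_def)
    next
      case 3
      then show ?thesis using v cen[of v] by (auto simp: par_def rank_def)
    qed
  qed
  moreover have "v \<in> C \<and> cen v \<in> C \<or> v \<notin> C \<and> par v = cen v \<or> cen v \<notin> C \<and> par (cen v) = v"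
    if v: "v \<in> V" "cen v \<noteq> v" for v
  proof (cases "v = entry (cen v)")
    case True
    then have "cen v \<notin> C" using entry(4) v by metis
    moreover have "par (cen v) = v" using True v cen(2) by (auto simp: par_def)
    ultimately show ?thesis by simp
  next
    case False
    show ?thesis
    proof (cases "v \<in> C")
      case True
      have "cen v \<in> C"
      proof (rule ccontr)
        assume out: "cen v \<notin> C"
        have "dist (entry (cen v)) = 0" using entry(3)[OF v(1)] dist(1)[OF True] by simp
        then have "entry (cen v) \<in> C" using dist(2)[of "entry (cen v)"] entry(1)[OF v(1)] by auto
        then have "v = entry (cen v)" using once[OF True] entry(2)[OF v(1)] out by auto
        with False show False by simp
      qed
      with True show ?thesis by simp
    next
      case out: False
      then show ?thesis using False v by (auto simp: par_def)
    qed
  qed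
  ultimately show ?thesis using that by blast
qed

section \<open>Girth and connectivity in terms of walks\<close>

text \<open>
  Positionwise, an arc list is a walk iff each arc starts where its predecessor ends; prepending
  \<open>u\<close> to the list of heads shifts it so that this becomes a comparison at equal positions.
\<close>

lemma pcas_nth:
  "pcas u p v \<longleftrightarrow>
    (\<forall>i<length p. fst (p ! i) = (u # map snd p) ! i) \<and> v = (u # map snd p) ! length p"
  by (induction p arbitrary: u) (auto simp: All_less_Suc2)

lemma pcas_pawalk_verts: "pcas u p v \<Longrightarrow> pawalk_verts u p = u # map snd p"
  by (induction p arbitrary: u) auto

lemma undirected_cycle_iff_closed_walk:
  assumes "pair_wf_digraph G"
  shows "(\<exists>p. undirected_cycle G p \<and> length p = n) \<longleftrightarrow>
    3 \<le> n \<and> (\<exists>f. closed_walk (parcs G) n f \<and> inj_on f {..<n})"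
proof -
  interpret pair_wf_digraph G by fact
  show ?thesis
  proof (intro iffI conjI; (elim conjE exE)?)
    fix p assume p: "undirected_cycle G p" "length p = n"
    then show n: "3 \<le> n" by (simp add: undirected_cycle_def)
    from p obtain u where u: "set p \<subseteq> parcs G" "pcas u p u" "distinct (tl (pawalk_verts u p))"
      by (auto simp: undirected_cycle_def cycle_def awalk_def)
    define f where "f i = (u # map snd p) ! i" for i
    have f: "(f i, f (Suc i)) = p ! i" if "i < n" for i
      using u(2) that p(2) unfolding pcas_nth by (auto simp: f_def prod_eq_iff)
    have wrap: "f n = f 0" using u(2) p(2) unfolding pcas_nth by (auto simp: f_def)
    have "distinct (map snd p)" using u(3) pcas_pawalk_verts[OF u(2)] by simp
    then have inj: "f (Suc i) = f (Suc j) \<longleftrightarrow> i = j" if "i < n" "j < n" for i j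
      using that p(2) by (simp add: f_def distinct_conv_nth) metis
    have "inj_on f {..<n}"
    proof (rule linorder_inj_onI)
      fix i j assume ij: "i < j" "i \<in> {..<n}" "j \<in> {..<n}"
      show "f i \<noteq> f j"
        using inj[of "i - 1" "j - 1"] inj[of "n - 1" "j - 1"] ij wrap by (cases "i = 0") auto
    qed auto
    moreover have "closed_walk (parcs G) n f"
      using f wrap u(1) p(2) by (auto simp: closed_walk_def)
    ultimately show "\<exists>f. closed_walk (parcs G) n f \<and> inj_on f {..<n}" by blast
  next
    fix f assume n: "3 \<le> n" and f: "closed_walk (parcs G) n f" "inj_on f {..<n}"
    interpret vertex_cycle f n using n f by unfold_locales (auto simp: closed_walk_def)
    define p where "p = map (\<lambda>i. (f i, f (Suc i))) [0..<n]"
    have nth: "(f 0 # map snd p) ! i = f i" if "i \<le> n" for i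
      using that by (cases i) (auto simp: p_def)
    have cas: "pcas (f 0) p (f 0)"
      unfolding pcas_nth using nth wrap by (auto simp: p_def)
    have sub: "set p \<subseteq> parcs G" using f(1) by (auto simp: p_def closed_walk_def)
    have "(f 0, f (Suc 0)) \<in> parcs G" using f(1) n by (auto simp: closed_walk_def)
    then have "f 0 \<in> pverts G" by (rule in_arcsD1)
    moreover have "distinct (map snd p)"
    proof -
      have "f (Suc i) \<noteq> f (Suc j)" if "i < j" "j < n" for i j
        using f_Suc_eq[of "Suc i" j] that by auto
      then have "inj_on (\<lambda>i. f (Suc i)) {..<n}" by (intro linorder_inj_onI) auto
      then show ?thesis by (simp add: p_def distinct_map comp_def lessThan_atLeast0)
    qed
    ultimately have "undirected_cycle G p"
      using cas sub n pcas_pawalk_verts[OF cas]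
      by (auto simp: undirected_cycle_def cycle_def awalk_def p_def)
    then show "\<exists>p. undirected_cycle G p \<and> length p = n" by (auto simp: p_def)
  qed
qed

lemma girth_eqI:
  assumes "pair_wf_digraph G" "closed_walk (parcs G) g f" "inj_on f {..<g}" "3 \<le> g"
    and "\<And>n h. \<lbrakk>closed_walk (parcs G) n h; inj_on h {..<n}; 3 \<le> n\<rbrakk> \<Longrightarrow> g \<le> n"
  shows "girth G = enat g"
proof (rule antisym)
  obtain p where "undirected_cycle G p" "length p = g"
    using undirected_cycle_iff_closed_walk[OF assms(1)] assms by metis
  then show "girth G \<le> enat g" unfolding girth_def by (metis INF_lower mem_Collect_eq)
  have "g \<le> length p" if "undirected_cycle G p" for p
    using undirected_cycle_iff_closed_walk[OF assms(1), of "length p"] assms(5) that by blast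
  then show "enat g \<le> girth G" unfolding girth_def by (intro INF_greatest) auto
qed

lemma odd_girth_eqI:
  assumes "pair_wf_digraph G" "closed_walk (parcs G) g f" "inj_on f {..<g}" "3 \<le> g" "odd g"
    and "\<And>n h. \<lbrakk>closed_walk (parcs G) n h; odd n\<rbrakk> \<Longrightarrow> g \<le> n"
  shows "odd_girth G = enat g"
proof (rule antisym)
  obtain p where "undirected_cycle G p" "length p = g"
    using undirected_cycle_iff_closed_walk[OF assms(1)] assms by metis
  then show "odd_girth G \<le> enat g" unfolding odd_girth_def using assms(5)
    by (metis (mono_tags, lifting) INF_lower mem_Collect_eq)
  have "g \<le> length p" if "undirected_cycle G p" "odd (length p)" for p
    using undirected_cycle_iff_closed_walk[OF assms(1), of "length p"] assms(6) that by blast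
  then show "enat g \<le> odd_girth G" unfolding odd_girth_def by (intro INF_greatest) auto
qed

lemma connected_graph_iff:
  assumes "pair_graph G"
  shows "connected_graph G \<longleftrightarrow>
    pverts G \<noteq> {} \<and> (\<forall>u\<in>pverts G. \<forall>v\<in>pverts G. (u, v) \<in> (parcs G)\<^sup>*)"
proof -
  interpret pair_graph G by fact
  have "reachable (with_proj G) u v \<longleftrightarrow> (u, v) \<in> (parcs G)\<^sup>*" if "u \<in> pverts G" "v \<in> pverts G" for u v
    using that reachable_conv by auto
  moreover have "reachable (mk_symmetric (with_proj G)) = reachable (with_proj G)"
    using reachable_mk_symmetric_eq[OF pair_sym_arcs] by blast
  ultimately show ?thesis
    using assms by (auto simp: connected_graph_def connected_def strongly_connected_def)
qed

section \<open>A cycle with attached trees\<close>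

text \<open>
  Trees hanging off a cycle, described by a parent for each vertex off the cycle. The rank rules out
  that following parents runs in a circle, so that every vertex eventually reaches the cycle.
\<close>

locale parent_forest = vertex_cycle f g for f :: "nat \<Rightarrow> 'a" and g +
  fixes V :: "'a set" and par :: "'a \<Rightarrow> 'a" and rank :: "'a \<Rightarrow> nat"
  assumes finite_V: "finite V"
    and C_subset: "C \<subseteq> V"
    and par_in: "v \<in> V - C \<Longrightarrow> par v \<in> V"
    and rank_par: "v \<in> V - C \<Longrightarrow> rank (par v) < rank v"
begin

definition H :: "'a pair_pre_digraph" where
  "H = \<lparr>pverts = V,
    parcs = walk_arcs g f \<union> (\<lambda>v. (v, par v)) ` (V - C) \<union> (\<lambda>v. (par v, v)) ` (V - C)\<rparr>"

lemma pverts_H [simp]: "pverts H = V" by (simp add: H_def)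

lemma parcs_H: "(u, v) \<in> parcs H \<longleftrightarrow>
    (u, v) \<in> walk_arcs g f \<or> u \<in> V - C \<and> v = par u \<or> v \<in> V - C \<and> u = par v"
  by (auto simp: H_def)

lemma sym_H: "sym (parcs H)"
  using sym_walk_arcs[of g f] by (auto simp: sym_def parcs_H)

lemma pair_graph_H: "pair_graph H"
proof
  show "fst e \<in> pverts H" "snd e \<in> pverts H" if "e \<in> parcs H" for e
    using that walk_arcs_subset C_subset par_in by (cases e; auto simp: parcs_H)+
  then have "parcs H \<subseteq> V \<times> V" by (auto simp: mem_Times_iff)
  then show "finite (parcs H)" using finite_V by (meson finite_SigmaI finite_subset)
  show "finite (pverts H)" using finite_V by simp
  show "fst e \<noteq> snd e" if "e \<in> parcs H" for e
    using that walk_arcs_irrefl rank_par by (cases e) (force simp: parcs_H)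
  show "symmetric (with_proj H)" using sym_H by (simp add: symmetric_def)
qed

lemma pair_wf_digraph_H: "pair_wf_digraph H"
  using pair_graph_H by (simp add: pair_graph_def pair_digraph_def pair_fin_digraph_def)

lemma closed_walk_H: "closed_walk (parcs H) g f"
  using wrap walk_arcs_forward by (auto simp: closed_walk_def parcs_H)

lemma connected_graph_H: "connected_graph H"
proof -
  have "(f 0, f i) \<in> (parcs H)\<^sup>*" if "i < g" for i
    using walk_segment_relpow[of g f "parcs H" 0 i] closed_walk_H that
    by (auto simp: closed_walk_def intro: relpow_imp_rtrancl)
  then have C: "(f 0, v) \<in> (parcs H)\<^sup>*" if "v \<in> C" for v using that by auto
  have from_0: "(f 0, v) \<in> (parcs H)\<^sup>*" if "v \<in> V" for v
    using that
  proof (induction "rank v" arbitrary: v rule: less_induct)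
    case less
    show ?case
    proof (cases "v \<in> C")
      case False
      then have "(f 0, par v) \<in> (parcs H)\<^sup>*" using less par_in rank_par by auto
      moreover have "(par v, v) \<in> parcs H" using False less by (simp add: parcs_H)
      ultimately show ?thesis by simp
    qed (rule C)
  qed
  then have "(v, f 0) \<in> (parcs H)\<^sup>*" if "v \<in> V" for v
    using that sym_rtrancl[OF sym_H] by (auto dest: symD)
  then have "(u, v) \<in> (parcs H)\<^sup>*" if "u \<in> V" "v \<in> V" for u v
    using that from_0 by (meson rtrancl_trans)
  moreover have "f 0 \<in> V" using C_subset length_ge_3 by auto
  ultimately show ?thesis
    unfolding connected_graph_iff[OF pair_graph_H] pverts_H by blast
qed

text \<open>
  The cycle contributes one edge per vertex, and each vertex off the cycle contributes the edge to
  its parent; by the rank these edges are different for different vertices.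
\<close>

lemma unicyclic_H: "unicyclic H"
proof -
  let ?A = "(\<lambda>i. {f i, f (Suc i)}) ` {..<g}" and ?B = "(\<lambda>v. {v, par v}) ` (V - C)"
  have "undirected_edges H = ?A \<union> ?B"
    by (auto simp: undirected_edges_def H_def walk_arcs_def image_Un image_image insert_commute)
  moreover have "?A \<inter> ?B = {}"
    using f_Suc_in_C by auto
  moreover have "inj_on (\<lambda>v. {v, par v}) (V - C)"
  proof (rule inj_onI, rule ccontr)
    fix u v assume uv: "u \<in> V - C" "v \<in> V - C" "{u, par u} = {v, par v}" "u \<noteq> v"
    then have "u = par v" "v = par u" by (auto simp: doubleton_eq_iff)
    then show False using rank_par[OF uv(1)] rank_par[OF uv(2)] by auto
  qed
  ultimately have "card (undirected_edges H) = g + card (V - C)"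
    using finite_V card_cycle_edges by (simp add: card_Un_disjoint card_image)
  also have "card (V - C) = card V - g"
    using C_subset card_cycle_vertices by (simp add: card_Diff_subset)
  also have "g + (card V - g) = card V"
    using card_mono[OF finite_V C_subset] card_cycle_vertices by simp
  finally show ?thesis using connected_graph_H by (simp add: unicyclic_def)
qed

text \<open>
  A vertex of maximal rank among the vertices of a cycle that are off \<open>C\<close> would have two distinct
  neighbours on that cycle, but both would be its parent. So the cycle stays within \<open>C\<close> and must
  be all of it.
\<close>

lemma cycle_length_H:
  assumes "closed_walk (parcs H) n h" "inj_on h {..<n}" "3 \<le> n"
  shows "g \<le> n"
proof -
  interpret h: vertex_cycle h n
    using assms by unfold_locales (auto simp: closed_walk_def)
  let ?S = "h ` {..<n}"
  have two: "\<exists>a\<in>?S. \<exists>b\<in>?S. a \<noteq> b \<and> (v, a) \<in> parcs H \<and> (v, b) \<in> parcs H" if "v \<in> ?S" for v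
    using h.two_cycle_neighbours[OF assms(1) sym_H that] .
  have "?S \<subseteq> C"
  proof (rule ccontr)
    assume "\<not> ?S \<subseteq> C"
    then have "Max (rank ` (?S - C)) \<in> rank ` (?S - C)" by (intro Max_in) auto
    then obtain v where v: "Max (rank ` (?S - C)) = rank v" "v \<in> ?S - C" by (rule imageE)
    then have max: "rank w \<le> rank v" if "w \<in> ?S - C" for w
      using that by (metis Max_ge finite_Diff finite_imageI finite_lessThan imageI)
    have "a = par v" if "a \<in> ?S" "(v, a) \<in> parcs H" for a
      using that v max[of a] rank_par[of a] walk_arcs_subset by (auto simp: parcs_H)
    moreover obtain a b where "a \<in> ?S" "b \<in> ?S" "a \<noteq> b" "(v, a) \<in> parcs H" "(v, b) \<in> parcs H"
      using two[of v] v(2) by blast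
    ultimately show False by metis
  qed
  have "(v, a) \<in> walk_arcs g f" if "v \<in> ?S" "a \<in> ?S" "(v, a) \<in> parcs H" for v a
    using that \<open>?S \<subseteq> C\<close> by (auto simp: parcs_H)
  then have "\<exists>a\<in>?S. \<exists>b\<in>?S. a \<noteq> b \<and> (v, a) \<in> walk_arcs g f \<and> (v, b) \<in> walk_arcs g f"
    if "v \<in> ?S" for v
    using two[OF that] that by blast
  moreover have "?S \<noteq> {}" using assms(3) by (auto simp: lessThan_empty_iff)
  ultimately have "?S = C"
    using vertex_set_closed_under_cycle[of ?S] \<open>?S \<subseteq> C\<close> by blast
  then show ?thesis using card_cycle_vertices h.card_cycle_vertices by simp
qed

lemma girth_H: "girth H = enat g"
  using girth_eqI[OF pair_wf_digraph_H closed_walk_H inj_f length_ge_3] cycle_length_H by blast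

end

section \<open>The spanning unicyclic subgraph\<close>

text \<open>
  The vertices reachable from a root by walks of even and of odd length cover a connected graph and
  form a bipartition as soon as they are disjoint; a common vertex yields an odd closed walk through
  the root.
\<close>

lemma odd_closed_walk_if_not_bipartite:
  assumes "connected_graph G" "\<not> bipartite G"
  obtains n x where "odd n" "(x, x) \<in> parcs G ^^ n"
proof -
  have G: "pair_graph G" using assms(1) by (simp add: connected_graph_def)
  then interpret pair_graph G .
  have sym: "sym (parcs G)" using pair_sym_arcs by (simp add: symmetric_def)
  obtain r where r: "r \<in> pverts G" and reach: "\<And>v. v \<in> pverts G \<Longrightarrow> (r, v) \<in> (parcs G)\<^sup>*"
    using assms(1) connected_graph_iff[OF G] by auto
  define A where "A = {v \<in> pverts G. \<exists>k. even k \<and> (r, v) \<in> parcs G ^^ k}"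
  define B where "B = {v \<in> pverts G. \<exists>k. odd k \<and> (r, v) \<in> parcs G ^^ k}"
  have "A \<union> B = pverts G"
    using rtrancl_imp_relpow[OF reach] by (auto simp: A_def B_def)
  moreover have "(u \<in> A \<longrightarrow> v \<in> B) \<and> (u \<in> B \<longrightarrow> v \<in> A)" if "(u, v) \<in> parcs G" for u v
  proof -
    have "(r, v) \<in> parcs G ^^ Suc k" if "(r, u) \<in> parcs G ^^ k" for k
      using that \<open>(u, v) \<in> parcs G\<close> by auto
    then show ?thesis unfolding A_def B_def using in_arcsD2[OF that]
      by (smt (verit) even_Suc mem_Collect_eq)
  qed
  moreover have "u \<in> pverts G" if "(u, v) \<in> parcs G" for u v
    using in_arcsD1[OF that] .
  ultimately have "\<forall>(u, v) \<in> parcs G. (u \<in> A \<and> v \<in> B) \<or> (u \<in> B \<and> v \<in> A)" "A \<union> B = pverts G"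
    by blast+
  then have "bipartite G" if "A \<inter> B = {}" using that unfolding bipartite_def by blast
  then have "A \<inter> B \<noteq> {}" using assms(2) by blast
  then obtain v k l where "even k" "(r, v) \<in> parcs G ^^ k" "odd l" "(r, v) \<in> parcs G ^^ l"
    by (auto simp: A_def B_def)
  then have "odd (k + l)" "(r, r) \<in> parcs G ^^ (k + l)"
    using sym_relpow_flip[OF sym] by (auto intro: relpow_trans)
  then show ?thesis by (rule that)
qed

lemma minimum_dominating_set:
  obtains D where "dominating_set G D" "card D = domination_number G"
proof -
  have "dominating_set G (pverts G)" by (simp add: dominating_set_def)
  then have "\<exists>k D. dominating_set G D \<and> card D = k" by blast
  then have "\<exists>D. dominating_set G D \<and> card D = domination_number G"
    unfolding domination_number_def by (rule LeastI_ex)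
  then show ?thesis using that by blast
qed

lemma domination_number_le: "dominating_set G D \<Longrightarrow> domination_number G \<le> card D"
  unfolding domination_number_def by (rule Least_le) blast

lemma dominating_set_mono:
  assumes "dominating_set H D" "pverts H = pverts G" "parcs H \<subseteq> parcs G"
  shows "dominating_set G D"
  using assms unfolding dominating_set_def by blast

theorem theorem3p1:
  fixes G :: "'a pair_pre_digraph"
  assumes "connected_graph G"
    and "\<not> bipartite G"
  shows "\<exists>H :: 'a pair_pre_digraph.
    unicyclic H \<and> spanning (with_proj H) (with_proj G) \<and>
    girth H = odd_girth G \<and> domination_number H = domination_number G"
proof -
  have graph_G: "pair_graph G" using assms(1) by (simp add: connected_graph_def)
  then interpret G: pair_graph G .
  let ?V = "pverts G" and ?E = "parcs G"
  have sym: "sym ?E" using G.pair_sym_arcs by (simp add: symmetric_def)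
  have irrefl: "(x, x) \<notin> ?E" for x using G.pair_no_loops[of "(x, x)"] by auto
  have sub: "?E \<subseteq> ?V \<times> ?V" using G.in_arcsD1 G.in_arcsD2 by auto
  have reach: "(u, v) \<in> ?E\<^sup>*" if "u \<in> ?V" "v \<in> ?V" for u v
    using assms(1) connected_graph_iff[OF graph_G] that by blast

  obtain D where D: "dominating_set G D" "card D = domination_number G"
    by (rule minimum_dominating_set)
  then have DV: "D \<subseteq> ?V" and dom: "\<And>v. v \<in> ?V - D \<Longrightarrow> \<exists>c\<in>D. (v, c) \<in> ?E"
    by (auto simp: dominating_set_def)
  have fin_D: "finite D" using DV G.pair_finite_verts by (rule finite_subset)

  define g where "g = (LEAST n. odd n \<and> (\<exists>x. (x, x) \<in> ?E ^^ n))"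
  have "\<exists>n. odd n \<and> (\<exists>x. (x, x) \<in> ?E ^^ n)"
    using odd_closed_walk_if_not_bipartite[OF assms] by metis
  then have "odd g \<and> (\<exists>x. (x, x) \<in> ?E ^^ g)" unfolding g_def by (rule LeastI_ex)
  then obtain x where g: "odd g" "(x, x) \<in> ?E ^^ g" by auto
  have g_le: "g \<le> n" if "odd n" "(x, x) \<in> ?E ^^ n" for n x
    unfolding g_def using that by (intro Least_le) auto
  have "\<exists>f. closed_walk ?E g f" using g(2) unfolding relpow_fun_conv closed_walk_def by auto
  moreover have "card (f ` {..<g} \<inter> D) < Suc (card D)" for f
    using card_mono[OF fin_D] by (simp add: less_Suc_eq_le)
  ultimately obtain f where f: "closed_walk ?E g f"
    and best: "\<And>f'. closed_walk ?E g f' \<Longrightarrow> card (f' ` {..<g} \<inter> D) \<le> card (f ` {..<g} \<inter> D)"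
    using ex_has_greatest_nat[of "closed_walk ?E g" _ "\<lambda>f. card (f ` {..<g} \<inter> D)" "Suc (card D)"]
    by (metis less_imp_le)

  interpret shortest_odd_walk ?E f g
    using sym irrefl f g(1) g_le by unfold_locales auto
  have CE: "walk_arcs g f \<subseteq> ?E"
    using step sym by (auto simp: walk_arcs_def dest: symD)
  have CV: "C \<subseteq> ?V" using step G.in_arcsD1 by auto

  obtain d where d: "\<And>v. v \<in> ?V - D \<Longrightarrow> d v \<in> D \<and> (v, d v) \<in> ?E"
    and needed_once: "\<And>x z. \<lbrakk>x \<in> C; z \<in> C; x \<in> ?V - D; z \<in> ?V - D; d x = d z; d x \<notin> C\<rbrakk> \<Longrightarrow> x = z"
    using private_dominators[OF fin_D dom best] by metis
  have reach_C: "\<exists>x\<in>C. (x, v) \<in> ?E\<^sup>*" if "v \<in> ?V" for v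
    using reach[of "f 0" v] that CV length_ge_3 by force
  obtain dist where dist: "\<And>v. v \<in> C \<Longrightarrow> dist v = (0::nat)"
    "\<And>v. v \<in> ?V - C \<Longrightarrow> \<exists>u\<in>?V. (v, u) \<in> ?E \<and> dist u < dist v"
    using distance_to_set[OF sym sub reach_C] by blast
  \<comment> \<open>The stars: the centres are the vertices of \<open>D\<close>, and every other vertex joins its dominator.\<close>
  define cen where "cen v = (if v \<in> D then v else d v)" for v
  have once: "x = z" if "x \<in> C" "z \<in> C" "cen x = cen z" "cen x \<notin> C" for x z
  proof -
    have "x \<notin> D" using that(1,4) by (metis cen_def)
    moreover have "z \<notin> D" using that(2-4) by (metis cen_def)
    ultimately show ?thesis using needed_once[of x z] that CV by (auto simp: cen_def)
  qed
  have cen: "cen v \<in> ?V" "cen (cen v) = cen v" "cen v \<noteq> v \<Longrightarrow> (v, cen v) \<in> ?E" if "v \<in> ?V" for v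
    using d[of v] that DV by (auto simp: cen_def)
  obtain par rank
    where par: "\<And>v. v \<in> ?V - C \<Longrightarrow> par v \<in> ?V \<and> (v, par v) \<in> ?E \<and> rank (par v) < (rank v :: nat)"
    and star: "\<And>v. \<lbrakk>v \<in> ?V; cen v \<noteq> v\<rbrakk> \<Longrightarrow> v \<in> C \<and> cen v \<in> C \<or> v \<notin> C \<and> par v = cen v
      \<or> cen v \<notin> C \<and> par (cen v) = v"
    using parents_along_stars[OF sym dist cen CV once] by blast

  interpret parent_forest f g ?V par rank
    using par CV G.pair_finite_verts by unfold_locales auto
  have HG: "parcs H \<subseteq> ?E"
    using CE par sym by (auto simp: H_def dest: symD)
  have "dominating_set H D"
    unfolding dominating_set_def
  proof (intro conjI ballI)
    show "D \<subseteq> pverts H" using DV by simp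
    fix v assume "v \<in> pverts H - D"
    then have v: "v \<in> ?V - D" by simp
    then have c: "cen v \<in> D" "(v, cen v) \<in> ?E" "cen v \<noteq> v" using d[OF v] by (auto simp: cen_def)
    \<comment> \<open>If the vertex and its dominator both lie on the cycle, their edge is a cycle edge, since a
      shortest odd cycle has no chords.\<close>
    have "(v, cen v) \<in> parcs H"
      using star[of v] v c cen(1)[of v] no_chord[of v "cen v"] by (auto simp: parcs_H)
    then show "\<exists>d\<in>D. (v, d) \<in> parcs H" using c(1) by blast
  qed
  then have "domination_number H \<le> domination_number G"
    using domination_number_le[of H D] D(2) by simp
  moreover obtain D' where "dominating_set H D'" "card D' = domination_number H"
    by (rule minimum_dominating_set)
  then have "domination_number G \<le> domination_number H"
    using domination_number_le[of G D'] dominating_set_mono[of H D' G] HG by simp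
  moreover have "spanning (with_proj H) (with_proj G)"
    using HG pair_wf_digraph_H G.pair_wf_digraph wf_digraph_wp_iff
    by (auto simp: spanning_def subgraph_def compatible_def)
  moreover have "odd_girth G = enat g"
  proof (rule odd_girth_eqI[OF _ f inj_f length_ge_3 g(1)])
    show "g \<le> n" if "closed_walk ?E n h" "odd n" for n h
    proof -
      have "(h 0, h 0) \<in> ?E ^^ n" using that(1) unfolding relpow_fun_conv closed_walk_def by auto
      then show ?thesis using g_le that(2) by blast
    qed
  qed unfold_locales
  ultimately show ?thesis
    using unicyclic_H girth_H by (intro exI[of _ H]) simp
qed

end
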